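(* There exist $2^{\mathfrak{c}}$ pairwise non-homeomorphic topologies $\tau\in\mathcal{L}$ such that $(\mathbb{R},\tau)$ is a completely normal space of first category (i.e. a meager space).
   Context: $\mathfrak{c}=|\mathbb{R}|$. $\eta$ denotes the Euclidean topology on $\mathbb{R}$. $\mathcal{L}$ denotes the family of all Hausdorff topologies $\tau$ on the set $\mathbb{R}$ with $\tau\subset\eta$. *)

theory Defs
  imports "HOL-Analysis.Analysis" "HOL-Library.Equipollence"
begin

definition in_L :: "real topology \<Rightarrow> bool" where
  "in_L \<tau> \<longleftrightarrow> topspace \<tau> = UNIV \<and> Hausdorff_space \<tau> \<and> (\<forall>U. openin \<tau> U \<longrightarrow> open U)"

definition nowhere_dense_in :: "'a topology \<Rightarrow> 'a set \<Rightarrow> bool" where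
  "nowhere_dense_in X A \<longleftrightarrow> A \<subseteq> topspace X \<and> X interior_of (X closure_of A) = {}"

definition meager_space :: "'a topology \<Rightarrow> bool" where
  "meager_space X \<longleftrightarrow>
     (\<exists>N :: nat \<Rightarrow> 'a set. (\<forall>n. nowhere_dense_in X (N n)) \<and> topspace X = (\<Union>n. N n))"

abbreviation completely_normal_space :: "'a topology \<Rightarrow> bool" where
  "completely_normal_space X \<equiv> hereditarily normal_space X"

end

theory Submission
  imports Defs
begin

text \<open>For \<open>A \<subseteq> \<nat>\<close> put \<open>s(A) = (\<Sum>n\<in>A. 2 ^ (- n\<^sup>2))\<close>, and let a family \<open>\<A>\<close> of sets of naturals
  induce on the reals the weakest topology making the characters
  \<open>t \<mapsto> exp (2 \<pi> i t s(A))\<close>, \<open>A \<in> \<A>\<close>, continuous. It is regular and coarser than the Euclidean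
  topology, hence hereditarily Lindelof and so completely normal; it is Hausdorff if \<open>\<A>\<close> contains
  \<open>{0}\<close> and an infinite \<open>E\<close>, because \<open>s({0}) = 1\<close> and \<open>s(E)\<close> is irrational. Since \<open>2 ^ N\<^sup>2 * s(A)\<close> is
  within \<open>2 ^ (-N)\<close> of an integer, \<open>t + 2 ^ N\<^sup>2\<close> converges to \<open>t\<close>, so the compact intervals
  \<open>[-n, n]\<close> are nowhere dense. Along an infinite set \<open>B\<close>, the sequence \<open>2 ^ N\<^sup>2 / 2\<close>
  is sent to \<open>-1\<close> in the limit by the character of \<open>B\<close> and to \<open>1\<close> by the character of any
  set almost disjoint from \<open>B\<close>; so an almost disjoint family of size continuum yields \<open>2 ^ c\<close>
  different topologies. A homeomorphism onto a given coarser Hausdorff topology is determined by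
  its values at the rationals, so every homeomorphism class has at most \<open>c\<close> members and there
  are \<open>2 ^ c\<close> classes.\<close>

subsection \<open>Characters with sparse binary frequencies\<close>

definition sparse_sum :: "nat set \<Rightarrow> real" where
  "sparse_sum A = (\<Sum>n. of_bool (n \<in> A) / 2 ^ n\<^sup>2)"

lemma square_gap: "N\<^sup>2 + N + Suc m \<le> (Suc N + m)\<^sup>2" for N m :: nat
  by (simp add: power2_eq_square algebra_simps)

text \<open>Scaling by \<open>2 ^ N\<^sup>2\<close> turns the terms before \<open>N\<close> into
  even integers, the term \<open>N\<close> into a digit and the rest into a tail \<open>e\<close>
  dominated by a geometric series. Evenness matters once half of this number becomes a
  phase.\<close>

lemma sparse_sum_shift:
  assumes "N > 0"
  obtains k :: int and e :: real
  where "2 ^ N\<^sup>2 * sparse_sum A = 2 * of_int k + of_bool (N \<in> A) + e"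
    and "0 \<le> e" "e \<le> (1/2) ^ N" "infinite A \<Longrightarrow> 0 < e"
proof -
  define f :: "nat \<Rightarrow> real" where "f n = of_bool (n \<in> A) / 2 ^ n\<^sup>2" for n
  define e where "e = (\<Sum>m. 2 ^ N\<^sup>2 * f (m + Suc N))"
  have le: "2 ^ N\<^sup>2 * f (m + Suc N) \<le> (1/2) ^ N * (1/2) ^ Suc m" for m
  proof -
    have "(2::real) ^ (N\<^sup>2 + N + Suc m) \<le> 2 ^ (m + Suc N)\<^sup>2"
      using square_gap[of N m] by (intro power_increasing) (auto simp: add.commute)
    then show ?thesis
      by (auto simp: f_def field_simps power_add)
  qed
  have nonneg: "0 \<le> 2 ^ N\<^sup>2 * f (m + Suc N)" for m
    by (simp add: f_def)
  have half: "(\<lambda>m. (1/2) ^ N * (1/2) ^ Suc m) sums ((1/2::real) ^ N)"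
    using sums_mult[OF power_half_series, of "(1/2) ^ N"] by simp
  have sm: "summable (\<lambda>m. 2 ^ N\<^sup>2 * f (m + Suc N))"
    by (rule summable_comparison_test'[OF sums_summable[OF half], of 0]) (use le nonneg in auto)
  then have "summable (\<lambda>m. f (m + Suc N))"
    by (subst (asm) summable_cmult_iff) auto
  then have sf: "summable f"
    by (simp only: summable_iff_shift)
  have "2 ^ N\<^sup>2 * sparse_sum A = (\<Sum>n<Suc N. 2 ^ N\<^sup>2 * f n) + e"
    unfolding sparse_sum_def f_def[symmetric] e_def
    using suminf_split_initial_segment[OF sf, of "Suc N"] suminf_mult[of "\<lambda>m. f (m + Suc N)" "2 ^ N\<^sup>2"]
      \<open>summable (\<lambda>m. f (m + Suc N))\<close>
    by (simp add: distrib_left del: sum.lessThan_Suc flip: sum_distrib_left)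
  also have "(\<Sum>n<Suc N. 2 ^ N\<^sup>2 * f n) = (\<Sum>n<N. 2 ^ N\<^sup>2 * f n) + of_bool (N \<in> A)"
    by (simp add: f_def)
  also have "(\<Sum>n<N. 2 ^ N\<^sup>2 * f n) = (\<Sum>n<N. 2 * of_int (of_bool (n \<in> A) * 2 ^ (N\<^sup>2 - n\<^sup>2 - 1)))"
  proof (intro sum.cong refl)
    fix n assume "n \<in> {..<N}"
    then have "n\<^sup>2 < N\<^sup>2"
      by (simp add: power_strict_mono)
    then have "N\<^sup>2 = n\<^sup>2 + Suc (N\<^sup>2 - n\<^sup>2 - 1)"
      by simp
    then have "(2::real) ^ N\<^sup>2 = 2 ^ n\<^sup>2 * (2 * 2 ^ (N\<^sup>2 - n\<^sup>2 - 1))"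
      by (metis power_Suc power_add)
    then show "2 ^ N\<^sup>2 * f n = 2 * of_int (of_bool (n \<in> A) * 2 ^ (N\<^sup>2 - n\<^sup>2 - 1))"
      by (simp add: f_def)
  qed
  also have "\<dots> = 2 * of_int (\<Sum>n<N. of_bool (n \<in> A) * 2 ^ (N\<^sup>2 - n\<^sup>2 - 1))"
    unfolding of_int_sum by (rule sum_distrib_left[symmetric])
  finally have eq: "2 ^ N\<^sup>2 * sparse_sum A = \<dots> + of_bool (N \<in> A) + e" .
  have "e \<le> (1/2) ^ N"
    unfolding e_def using suminf_le[OF le sm sums_summable[OF half]] sums_unique[OF half] by simp
  moreover have "0 \<le> e"
    unfolding e_def by (intro suminf_nonneg sm nonneg)
  moreover have "0 < e" if inf: "infinite A"
  proof -
    obtain n where "n > N" "n \<in> A"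
      using inf by (meson infinite_nat_iff_unbounded)
    then have "0 < 2 ^ N\<^sup>2 * f ((n - Suc N) + Suc N)"
      by (simp add: f_def)
    then show ?thesis
      unfolding e_def using suminf_pos2[OF sm nonneg] by blast
  qed
  ultimately show thesis
    using eq that by blast
qed

lemma sparse_sum_singleton_0 [simp]: "sparse_sum {0} = 1"
proof -
  have "(\<Sum>n. of_bool (n \<in> {0}) / 2 ^ n\<^sup>2 :: real) = (\<Sum>n\<in>{0}. of_bool (n \<in> {0::nat}) / 2 ^ n\<^sup>2)"
    by (rule suminf_finite) auto
  then show ?thesis
    by (simp add: sparse_sum_def)
qed

text \<open>If the product were an integer, so would be \<open>k * e\<close> for the tail
  \<open>e\<close> of \<open>sparse_sum_shift\<close>; but for large \<open>N\<close> it is nonzero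
  and of absolute value below 1.\<close>

lemma multiple_sparse_sum_notin_Ints:
  assumes "infinite A" "k \<noteq> (0::int)"
  shows "of_int k * sparse_sum A \<notin> \<int>"
proof
  assume "of_int k * sparse_sum A \<in> \<int>"
  then obtain l where l: "of_int k * sparse_sum A = of_int l"
    by (auto elim: Ints_cases)
  obtain n where n: "(1/2::real) ^ n < 1 / \<bar>of_int k\<bar>"
    using real_arch_pow_inv[of "1 / \<bar>of_int k\<bar>" "1/2"] assms by auto
  \<comment> \<open>The successor guarantees \<open>N > 0\<close>, as
    \<open>sparse_sum_shift\<close> demands, and preserves the bound.\<close>
  define N where "N = Suc n"
  have "(1/2::real) ^ N \<le> (1/2) ^ n"
    unfolding N_def by (intro power_decreasing) auto
  with n have N: "(1/2::real) ^ N < 1 / \<bar>of_int k\<bar>" "N > 0"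
    by (linarith, simp add: N_def)
  obtain j e where je: "2 ^ N\<^sup>2 * sparse_sum A = 2 * of_int j + of_bool (N \<in> A) + e"
    and e: "0 \<le> e" "e \<le> (1/2) ^ N" "infinite A \<Longrightarrow> 0 < e"
    using sparse_sum_shift[OF N(2)] by metis
  have "of_int k * e = of_int (2 ^ N\<^sup>2 * l - k * (2 * j + of_bool (N \<in> A)))"
  proof -
    have "of_int k * (2 * of_int j + of_bool (N \<in> A) + e) = 2 ^ N\<^sup>2 * of_int l"
      using je l by (metis mult.left_commute)
    then show ?thesis
      by (simp add: algebra_simps)
  qed
  then obtain i :: int where i: "of_int k * e = of_int i" by blast
  have "e * \<bar>of_int k\<bar> < 1"
    using e(2) N(1) assms(2) by (simp flip: pos_less_divide_eq)
  then have "\<bar>of_int k * e\<bar> < 1"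
    using e(1) by (simp add: abs_mult mult.commute)
  then have "i = 0"
    unfolding i by linarith
  with i e assms show False by simp
qed

definition sparse_char :: "nat set \<Rightarrow> real \<Rightarrow> complex" where
  "sparse_char A t = cis (2 * pi * (t * sparse_sum A))"

lemma sparse_char_add: "sparse_char A (s + t) = sparse_char A s * sparse_char A t"
  by (simp add: sparse_char_def cis_mult algebra_simps)

lemma sparse_char_0 [simp]: "sparse_char A 0 = 1"
  by (simp add: sparse_char_def)

lemma continuous_on_sparse_char: "continuous_on S (sparse_char A)"
  unfolding sparse_char_def by (intro continuous_intros)

lemma cis_2pi_add_int: "cis (2 * pi * (of_int k + x)) = cis (2 * pi * x)"
  unfolding distrib_left cis_mult[symmetric] by simp

text \<open>Halving the scaled sum leaves an integer plus half the digit plus half the tail, so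
  membership of \<open>N\<close> in \<open>A\<close> shows up as a sign.\<close>

lemma sparse_char_half_power:
  obtains e :: "nat \<Rightarrow> real"
  where "e \<longlonglongrightarrow> 0"
    and "\<And>N. N > 0 \<Longrightarrow> sparse_char A (2 ^ N\<^sup>2 / 2) = (if N \<in> A then -1 else 1) * cis (pi * e N)"
proof -
  have "\<exists>e. N > 0 \<longrightarrow> \<bar>e\<bar> \<le> (1/2) ^ N \<and>
     sparse_char A (2 ^ N\<^sup>2 / 2) = (if N \<in> A then -1 else 1) * cis (pi * e)" for N
  proof (cases "N > 0")
    case True
    then obtain k e where je: "2 ^ N\<^sup>2 * sparse_sum A = 2 * of_int k + of_bool (N \<in> A) + e"
      and e: "0 \<le> e" "e \<le> (1/2) ^ N"
      using sparse_sum_shift by metis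
    have "sparse_char A (2 ^ N\<^sup>2 / 2) = cis (2 * pi * (of_int k + (of_bool (N \<in> A) + e) / 2))"
      using je by (simp add: sparse_char_def field_simps)
    also have "\<dots> = cis (pi * of_bool (N \<in> A) + pi * e)"
      unfolding cis_2pi_add_int by (rule arg_cong[of _ _ cis]) (simp add: field_simps)
    also have "\<dots> = (if N \<in> A then -1 else 1) * cis (pi * e)"
      unfolding cis_mult[symmetric] by simp
    finally show ?thesis
      using e by (intro exI[of _ e]) auto
  qed auto
  then obtain e where e: "\<And>N. N > 0 \<Longrightarrow> \<bar>e N\<bar> \<le> (1/2) ^ N"
    and *: "\<And>N. N > 0 \<Longrightarrow> sparse_char A (2 ^ N\<^sup>2 / 2) = (if N \<in> A then -1 else 1) * cis (pi * e N)"
    by metis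
  have "(\<lambda>N. (1/2::real) ^ N) \<longlonglongrightarrow> 0"
    by (intro LIMSEQ_power_zero) auto
  then have "e \<longlonglongrightarrow> 0"
    by (rule Lim_null_comparison[rotated])
       (use e in \<open>auto simp: eventually_sequentially intro!: exI[of _ 1]\<close>)
  with * that show thesis by blast
qed

lemma tendsto_sparse_char_recurrence:
  "(\<lambda>N. sparse_char A (t + 2 ^ N\<^sup>2)) \<longlonglongrightarrow> sparse_char A t"
proof -
  obtain e where e: "e \<longlonglongrightarrow> 0"
    and *: "\<And>N. N > 0 \<Longrightarrow> sparse_char A (2 ^ N\<^sup>2 / 2) = (if N \<in> A then -1 else 1) * cis (pi * e N)"
    using sparse_char_half_power by blast
  have "(\<lambda>N. sparse_char A t * (cis (pi * e N) * cis (pi * e N))) \<longlonglongrightarrow> sparse_char A t * (cis (pi * 0) * cis (pi * 0))"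
    by (intro tendsto_intros e)
  \<comment> \<open>The shift is twice \<open>2 ^ N\<^sup>2 / 2\<close>, so the sign is squared
    away.\<close>
  moreover have "sparse_char A (t + 2 ^ N\<^sup>2) = sparse_char A t * (cis (pi * e N) * cis (pi * e N))"
    if "N > 0" for N
    using sparse_char_add[of A "2 ^ N\<^sup>2 / 2" "2 ^ N\<^sup>2 / 2"] *[OF that] by (simp add: sparse_char_add)
  then have "\<forall>\<^sub>F N in sequentially. sparse_char A t * (cis (pi * e N) * cis (pi * e N)) = sparse_char A (t + 2 ^ N\<^sup>2)"
    by (auto simp: eventually_sequentially intro!: exI[of _ 1])
  ultimately show ?thesis
    by (simp add: tendsto_cong)
qed

text \<open>The filter lets \<open>N\<close> tend to infinity inside \<open>B\<close>; past the
  finite intersection such \<open>N\<close> lie outside \<open>A\<close>, so the sign is 1.\<close>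

lemma tendsto_sparse_char_almost_disjoint:
  assumes "finite (A \<inter> B)"
  shows "((\<lambda>N. sparse_char A (2 ^ N\<^sup>2 / 2)) \<longlongrightarrow> 1) (inf sequentially (principal B))"
proof -
  obtain e where e: "e \<longlonglongrightarrow> 0"
    and *: "\<And>N. N > 0 \<Longrightarrow> sparse_char A (2 ^ N\<^sup>2 / 2) = (if N \<in> A then -1 else 1) * cis (pi * e N)"
    using sparse_char_half_power by blast
  have "(\<lambda>N. cis (pi * e N)) \<longlonglongrightarrow> cis (pi * 0)"
    by (intro tendsto_intros e)
  then have lim: "((\<lambda>N. cis (pi * e N)) \<longlongrightarrow> 1) (inf sequentially (principal B))"
    by (metis cis_zero inf_le1 mult_zero_right tendsto_mono)
  obtain m where m: "A \<inter> B \<subseteq> {..<m}"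
    using assms by (auto simp: finite_nat_iff_bounded)
  have "cis (pi * e N) = sparse_char A (2 ^ N\<^sup>2 / 2)" if "N \<ge> Suc m" "N \<in> B" for N
  proof -
    from that m have "N > 0" "N \<notin> A"
      by auto
    with * show ?thesis by simp
  qed
  then have "\<forall>\<^sub>F N in inf sequentially (principal B). cis (pi * e N) = sparse_char A (2 ^ N\<^sup>2 / 2)"
    unfolding eventually_inf_principal eventually_sequentially by blast
  with lim show ?thesis
    by (simp add: tendsto_cong)
qed

lemma tendsto_sparse_char_self:
  "((\<lambda>N. sparse_char B (2 ^ N\<^sup>2 / 2)) \<longlongrightarrow> -1) (inf sequentially (principal B))"
proof -
  obtain e where e: "e \<longlonglongrightarrow> 0"
    and *: "\<And>N. N > 0 \<Longrightarrow> sparse_char B (2 ^ N\<^sup>2 / 2) = (if N \<in> B then -1 else 1) * cis (pi * e N)"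
    using sparse_char_half_power by blast
  have "(\<lambda>N. - cis (pi * e N)) \<longlonglongrightarrow> - cis (pi * 0)"
    by (intro tendsto_intros e)
  then have lim: "((\<lambda>N. - cis (pi * e N)) \<longlongrightarrow> -1) (inf sequentially (principal B))"
    by (metis cis_zero inf_le1 mult_zero_right tendsto_mono)
  have "\<forall>\<^sub>F N in inf sequentially (principal B). - cis (pi * e N) = sparse_char B (2 ^ N\<^sup>2 / 2)"
    unfolding eventually_inf_principal eventually_sequentially using *
    by (intro exI[of _ 1]) auto
  with lim show ?thesis
    by (simp add: tendsto_cong)
qed

text \<open>Frequency 1 forces \<open>s - t\<close> to be an integer, and the irrational frequency
  of \<open>E\<close> forces that integer to be 0.\<close>

lemma sparse_char_separates:
  assumes "infinite E" "sparse_char {0} s = sparse_char {0} t" "sparse_char E s = sparse_char E t"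
  shows "s = t"
proof -
  have int: "x - y \<in> \<int>" if eq: "cis (2 * pi * x) = cis (2 * pi * y)" for x y
  proof -
    obtain n where "2 * pi * x = 2 * pi * y + 2 * pi * of_int n"
      using eq sin_cos_eq_iff[of "2 * pi * x" "2 * pi * y"] unfolding complex_eq_iff cis.sel by metis
    then have "2 * pi * x = 2 * pi * (y + of_int n)"
      by (simp add: distrib_left)
    then have "x - y = of_int n"
      by simp
    then show ?thesis by simp
  qed
  obtain k :: int where k: "s - t = of_int k"
    using int[of s t] assms(2) by (auto simp: sparse_char_def elim: Ints_cases)
  have "(s - t) * sparse_sum E \<in> \<int>"
    using int[of "s * sparse_sum E" "t * sparse_sum E"] assms(3)
    by (simp add: sparse_char_def left_diff_distrib)
  then show ?thesis
    using multiple_sparse_sum_notin_Ints[OF assms(1), of k] k by fastforce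
qed

subsection \<open>Topologies generated by characters\<close>

lemma limitin_pullback_topology:
  assumes "g ` UNIV \<subseteq> topspace Y"
  shows "limitin (pullback_topology UNIV g Y) f l F \<longleftrightarrow> limitin Y (\<lambda>x. g (f x)) (g l) F"
  using assms unfolding limitin_def openin_pullback_topology topspace_pullback_topology by auto

lemma embedding_map_pullback_topology:
  assumes "inj g" "range g \<subseteq> topspace Y"
  shows "embedding_map (pullback_topology UNIV g Y) Y g"
proof -
  have top: "topspace (pullback_topology UNIV g Y) = UNIV"
    using assms by (auto simp: topspace_pullback_topology)
  have "continuous_map (pullback_topology UNIV g Y) Y g"
    using continuous_map_pullback[OF continuous_map_id, of UNIV g Y] by (simp add: o_def id_def)
  moreover have "open_map (pullback_topology UNIV g Y) (subtopology Y (range g)) g"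
    unfolding open_map_def openin_pullback_topology openin_subtopology by auto
  ultimately show ?thesis
    unfolding embedding_map_def top using assms
    by (intro bijective_open_imp_homeomorphic_map)
       (auto simp: top continuous_map_in_subtopology topspace_subtopology)
qed

text \<open>Any family of \<open>\<tau>\<close>-open sets is open in a second countable topology, so
  a countable subfamily has the same union. Hence every subspace is Lindelof, and regular Lindelof
  spaces are normal.\<close>

lemma hereditarily_normal_coarser:
  fixes \<tau> :: "'a :: second_countable_topology topology"
  assumes top: "topspace \<tau> = UNIV" and coarser: "\<And>U. openin \<tau> U \<Longrightarrow> open U" and reg: "regular_space \<tau>"
  shows "hereditarily normal_space \<tau>"
  unfolding hereditarily
proof (intro allI regular_Lindelof_imp_normal_space)
  fix S
  show "regular_space (subtopology \<tau> S)"
    by (rule regular_space_subtopology[OF reg])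
  show "Lindelof_space (subtopology \<tau> S)"
    unfolding Lindelof_space_subtopology_subset[of S \<tau>, unfolded top, OF subset_UNIV]
  proof (intro allI impI)
    fix \<U> assume \<U>: "(\<forall>U\<in>\<U>. openin \<tau> U) \<and> S \<subseteq> \<Union> \<U>"
    then obtain \<V> where \<V>: "\<V> \<subseteq> \<U>" "countable \<V>" "\<Union>\<V> = \<Union>\<U>"
      using Lindelof[of \<U>] coarser by metis
    then show "\<exists>\<V>. countable \<V> \<and> \<V> \<subseteq> \<U> \<and> S \<subseteq> \<Union> \<V>"
      using \<U> by (intro exI[of _ \<V>]) simp
  qed
qed

definition bohr_embedding :: "nat set set \<Rightarrow> real \<Rightarrow> nat set \<Rightarrow> complex" where
  "bohr_embedding \<A> t = (\<lambda>A\<in>\<A>. sparse_char A t)"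

text \<open>This is the initial topology of the characters, written as a pullback so that separation
  properties pass down from the product.\<close>

definition bohr_topology :: "nat set set \<Rightarrow> real topology" where
  "bohr_topology \<A> = pullback_topology UNIV (bohr_embedding \<A>) (product_topology (\<lambda>_. euclidean) \<A>)"

lemma range_bohr_embedding: "range (bohr_embedding \<A>) \<subseteq> topspace (product_topology (\<lambda>_. euclidean) \<A>)"
  by (auto simp: bohr_embedding_def)

lemma topspace_bohr_topology [simp]: "topspace (bohr_topology \<A>) = UNIV"
  using range_bohr_embedding[of \<A>] by (auto simp: bohr_topology_def topspace_pullback_topology)

lemma limitin_bohr_topology:
  "limitin (bohr_topology \<A>) f l F \<longleftrightarrow> (\<forall>A\<in>\<A>. ((\<lambda>x. sparse_char A (f x)) \<longlongrightarrow> sparse_char A l) F)"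
  unfolding bohr_topology_def limitin_pullback_topology[OF range_bohr_embedding] limitin_componentwise
  by (simp add: bohr_embedding_def)

lemma bohr_topology_coarser:
  assumes "openin (bohr_topology \<A>) U"
  shows "open U"
proof -
  have "continuous_map euclidean (product_topology (\<lambda>_. euclidean) \<A>) (bohr_embedding \<A>)"
    by (auto simp: continuous_map_componentwise bohr_embedding_def continuous_on_sparse_char)
  then have "continuous_map euclidean (bohr_topology \<A>) id"
    unfolding bohr_topology_def by (intro continuous_map_pullback') auto
  from openin_continuous_map_preimage[OF this assms] show ?thesis
    by simp
qed

section \<open>Separation, complete normality and meagerness\<close>

locale separating_family =
  fixes \<A> :: "nat set set" and E :: "nat set"
  assumes singleton_0: "{0} \<in> \<A>" and E: "E \<in> \<A>" "infinite E"
begin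

lemma inj_bohr_embedding: "inj (bohr_embedding \<A>)"
proof (rule injI)
  fix s t assume "bohr_embedding \<A> s = bohr_embedding \<A> t"
  then have "sparse_char A s = sparse_char A t" if "A \<in> \<A>" for A
    using that by (metis bohr_embedding_def restrict_apply')
  with singleton_0 E show "s = t"
    by (blast intro: sparse_char_separates)
qed

lemma Hausdorff_bohr_topology: "Hausdorff_space (bohr_topology \<A>)"
  and regular_bohr_topology: "regular_space (bohr_topology \<A>)"
proof -
  have hom: "bohr_topology \<A> homeomorphic_space
      subtopology (product_topology (\<lambda>_. euclidean) \<A>) (range (bohr_embedding \<A>))"
    using embedding_map_imp_homeomorphic_space
        [OF embedding_map_pullback_topology[OF inj_bohr_embedding range_bohr_embedding]]
    by (metis bohr_topology_def topspace_bohr_topology)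
  show "Hausdorff_space (bohr_topology \<A>)"
    unfolding homeomorphic_Hausdorff_space[OF hom]
    by (intro Hausdorff_space_subtopology) (simp add: Hausdorff_space_product_topology)
  show "regular_space (bohr_topology \<A>)"
    unfolding homeomorphic_regular_space[OF hom]
    by (intro regular_space_subtopology) (simp add: regular_space_product_topology regular_space_euclidean)
qed

lemma in_L_bohr_topology: "in_L (bohr_topology \<A>)"
  by (simp add: in_L_def Hausdorff_bohr_topology bohr_topology_coarser)

lemma completely_normal_bohr_topology: "completely_normal_space (bohr_topology \<A>)"
  by (intro hereditarily_normal_coarser regular_bohr_topology bohr_topology_coarser) auto

lemma meager_bohr_topology: "meager_space (bohr_topology \<A>)"
  unfolding meager_space_def
proof (intro exI[of _ "\<lambda>n. {- real n..real n}"] conjI allI)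
  show "topspace (bohr_topology \<A>) = (\<Union>n. {- real n..real n})"
  proof -
    have "\<exists>n. x \<in> {- real n..real n}" for x :: real
    proof -
      obtain n where "\<bar>x\<bar> \<le> real n"
        using real_arch_simple by blast
      then show ?thesis
        by (intro exI[of _ n]) auto
    qed
    then show ?thesis by auto
  qed
  fix n
  \<comment> \<open>Intervals stay compact in the coarser topology, and compact sets in a Hausdorff
    space are closed.\<close>
  have cont: "continuous_map euclidean (bohr_topology \<A>) id"
    by (auto simp: continuous_map_def bohr_topology_coarser)
  have "compactin (bohr_topology \<A>) {- real n..real n}"
    using image_compactin[OF _ cont, of "{- real n..real n}"] by (simp add: compact_Icc)
  then have "closedin (bohr_topology \<A>) {- real n..real n}"
    by (rule compactin_imp_closedin[OF Hausdorff_bohr_topology])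
  then have closed: "bohr_topology \<A> closure_of {- real n..real n} = {- real n..real n}"
    by (simp add: closure_of_closedin)
  have "t \<notin> bohr_topology \<A> interior_of {- real n..real n}" for t
  proof
    assume t: "t \<in> bohr_topology \<A> interior_of {- real n..real n}"
    \<comment> \<open>The shifts of \<open>t\<close> converge back to \<open>t\<close> in this
      topology, yet they leave every bounded interval.\<close>
    have "limitin (bohr_topology \<A>) (\<lambda>N. t + 2 ^ N\<^sup>2) t sequentially"
      by (simp add: limitin_bohr_topology tendsto_sparse_char_recurrence)
    then have "\<forall>\<^sub>F N in sequentially. t + 2 ^ N\<^sup>2 \<in> {- real n..real n}"
      using t unfolding limitin_def
      by (metis (mono_tags, lifting) eventually_mono interior_of_subset openin_interior_of subsetD)
    moreover have "\<forall>\<^sub>F N in sequentially. t + 2 ^ N\<^sup>2 > real n"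
    proof -
      have "real n < t + 2 ^ N\<^sup>2" if "N \<ge> nat \<lceil>real n - t\<rceil>" for N
      proof -
        have "real n - t \<le> real N"
          using that by linarith
        also have "\<dots> \<le> real (N\<^sup>2)"
          by (simp only: of_nat_le_iff power2_eq_square le_square)
        also have "\<dots> < 2 ^ N\<^sup>2"
          by (rule of_nat_less_two_power)
        finally show ?thesis by simp
      qed
      then show ?thesis
        by (rule eventually_sequentiallyI)
    qed
    ultimately have "\<forall>\<^sub>F N::nat in sequentially. False"
      by eventually_elim auto
    then show False by simp
  qed
  then show "nowhere_dense_in (bohr_topology \<A>) {- real n..real n}"
    by (auto simp: nowhere_dense_in_def closed)
qed

end

text \<open>Along \<open>B\<close> the sequence \<open>2 ^ N\<^sup>2 / 2\<close> converges to 0 for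
  \<open>\<A>\<close>, but not for \<open>\<B>\<close>, where the character of \<open>B\<close>
  tends to -1 instead of 1.\<close>

lemma bohr_topology_separated:
  assumes "B \<in> \<B>" "infinite B" "\<And>A. A \<in> \<A> \<Longrightarrow> finite (A \<inter> B)"
  shows "bohr_topology \<A> \<noteq> bohr_topology \<B>"
proof
  assume eq: "bohr_topology \<A> = bohr_topology \<B>"
  let ?F = "inf sequentially (principal B)"
  have "?F \<noteq> bot"
    using assms(2) unfolding trivial_limit_def eventually_inf_principal eventually_sequentially
    by (meson infinite_nat_iff_unbounded_le)
  have "limitin (bohr_topology \<A>) (\<lambda>N. 2 ^ N\<^sup>2 / 2) 0 ?F"
    using assms(3) by (simp add: limitin_bohr_topology tendsto_sparse_char_almost_disjoint)
  then have "((\<lambda>N. sparse_char B (2 ^ N\<^sup>2 / 2)) \<longlongrightarrow> 1) ?F"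
    using assms(1) by (simp add: eq limitin_bohr_topology)
  then have "(-1::complex) = 1"
    using tendsto_unique[OF \<open>?F \<noteq> bot\<close>] tendsto_sparse_char_self by blast
  then show False by simp
qed

subsection \<open>An almost disjoint family of frequencies\<close>

text \<open>The initial segments of two different sets differ from some point on, so the sets
  \<open>branch P\<close> of codes of initial segments are almost disjoint. The codes are odd to keep them
  away from the even numbers, which belong to every \<open>branch_family\<close> below.\<close>

definition branch :: "nat set \<Rightarrow> nat set" where
  "branch P = range (\<lambda>n. Suc (2 * prod_encode (n, set_encode (P \<inter> {..<n}))))"

lemma infinite_branch: "infinite (branch P)"
  unfolding branch_def by (intro range_inj_infinite injI) simp

lemma odd_branch: "n \<in> branch P \<Longrightarrow> odd n"
  by (auto simp: branch_def)

lemma finite_branch_Int: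
  assumes "P \<noteq> Q"
  shows "finite (branch P \<inter> branch Q)"
proof -
  obtain k where k: "(k \<in> P) \<noteq> (k \<in> Q)"
    using assms by blast
  \<comment> \<open>A common code yields the same \<open>n\<close> and the same initial segment
    below \<open>n\<close>; for \<open>n > k\<close> the point \<open>k\<close> would tell the
    segments apart.\<close>
  have "branch P \<inter> branch Q \<subseteq> (\<lambda>n. Suc (2 * prod_encode (n, set_encode (P \<inter> {..<n})))) ` {..k}"
  proof
    fix x assume "x \<in> branch P \<inter> branch Q"
    then obtain n where x: "x = Suc (2 * prod_encode (n, set_encode (P \<inter> {..<n})))"
      and "set_encode (P \<inter> {..<n}) = set_encode (Q \<inter> {..<n})"
      by (auto simp: branch_def)
    then have "P \<inter> {..<n} = Q \<inter> {..<n}"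
      using inj_on_set_encode by (auto dest!: inj_onD)
    with k have "n \<le> k"
      by (metis Int_iff lessThan_iff not_le_imp_less)
    with x show "x \<in> (\<lambda>n. Suc (2 * prod_encode (n, set_encode (P \<inter> {..<n})))) ` {..k}"
      by blast
  qed
  then show ?thesis
    by (rule finite_subset) simp
qed

text \<open>The two fixed members make the family separating for every \<open>X\<close>, even the
  empty one.\<close>

definition branch_family :: "nat set set \<Rightarrow> nat set set" where
  "branch_family X = {{0}, {n. even n}} \<union> branch ` X"

lemma infinite_evens: "infinite {n::nat. even n}"
proof -
  have "infinite (range (\<lambda>n::nat. 2 * n))"
    by (intro range_inj_infinite injI) simp
  then show ?thesis
    by (rule infinite_super[rotated]) auto
qed

interpretation branch: separating_family "branch_family X" "{n. even n}" for X
  by unfold_locales (auto simp: branch_family_def infinite_evens)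

lemma bohr_topology_branch_family_neq:
  assumes "P \<in> X" "P \<notin> Y"
  shows "bohr_topology (branch_family Y) \<noteq> bohr_topology (branch_family X)"
proof (rule bohr_topology_separated)
  show "branch P \<in> branch_family X"
    using assms by (simp add: branch_family_def)
  show "infinite (branch P)"
    by (rule infinite_branch)
  have "{n. even n} \<inter> branch P = {}"
    using odd_branch by auto
  moreover have "finite (branch Q \<inter> branch P)" if "Q \<in> Y" for Q
    using that assms by (intro finite_branch_Int) auto
  ultimately show "finite (A \<inter> branch P)" if "A \<in> branch_family Y" for A
    using that by (auto simp: branch_family_def)
qed

lemma inj_bohr_topology_branch_family: "inj (\<lambda>X. bohr_topology (branch_family X))"
  by (rule injI) (metis bohr_topology_branch_family_neq subsetI subset_antisym)

subsection \<open>Counting homeomorphism classes\<close>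

text \<open>Both maps are also continuous for the finer Euclidean topology, in which the rationals
  are dense.\<close>

lemma continuous_from_reals_eqI:
  assumes "in_L \<tau>1" "in_L \<tau>2" "Hausdorff_space \<sigma>"
    and f: "continuous_map \<tau>1 \<sigma> f" and g: "continuous_map \<tau>2 \<sigma> g"
    and eq: "\<And>q. q \<in> \<rat> \<Longrightarrow> f q = g q"
  shows "f = g"
proof
  fix x :: real
  have "continuous_map euclidean \<sigma> h" if "in_L \<tau>" "continuous_map \<tau> \<sigma> h" for \<tau> h
    using that by (auto simp: in_L_def continuous_map_def)
  moreover have "x \<in> euclidean closure_of \<rat>"
    by (simp add: Rats_closure_real)
  ultimately show "f x = g x"
    using forall_in_closure_of_eq[of x euclidean \<rat> \<sigma> f g] assms by blast
qed

text \<open>A homeomorphism onto \<open>\<sigma>\<close> is encoded by its restriction to the rationals, i.e. by a set of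
  pairs of rationals, i.e. by a set of natural numbers.\<close>

lemma homeomorphism_class_lepoll:
  assumes \<sigma>: "in_L \<sigma>"
  shows "{\<tau>. in_L \<tau> \<and> \<tau> homeomorphic_space \<sigma>} \<lesssim> (UNIV :: nat set set)"
proof -
  define h where "h \<tau> = (SOME f. homeomorphic_map \<tau> \<sigma> f)" for \<tau> :: "real topology"
  have h: "homeomorphic_map \<tau> \<sigma> (h \<tau>)" if "\<tau> homeomorphic_space \<sigma>" for \<tau>
    unfolding h_def using that by (metis homeomorphic_space someI_ex)
  \<comment> \<open>A real is determined by the rationals below it, so these pairs record
    \<open>h \<tau>\<close> on the rationals.\<close>
  define C where "C \<tau> = to_nat ` {(p, q). of_rat q < h \<tau> (of_rat p)}" for \<tau>
  have "inj_on C {\<tau>. in_L \<tau> \<and> \<tau> homeomorphic_space \<sigma>}"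
  proof (rule inj_onI, clarify)
    fix \<tau>1 \<tau>2
    assume L: "in_L \<tau>1" "in_L \<tau>2" and hom: "\<tau>1 homeomorphic_space \<sigma>" "\<tau>2 homeomorphic_space \<sigma>"
      and "C \<tau>1 = C \<tau>2"
    then have "{(p, q). of_rat q < h \<tau>1 (of_rat p)} = {(p, q). of_rat q < h \<tau>2 (of_rat p)}"
      by (simp add: C_def inj_image_eq_iff)
    then have iff: "of_rat q < h \<tau>1 (of_rat p) \<longleftrightarrow> of_rat q < h \<tau>2 (of_rat p)" for p q
      by (auto simp: set_eq_iff)
    have "h \<tau>1 (of_rat p) = h \<tau>2 (of_rat p)" for p
      using iff by (metis linorder_neqE of_rat_dense order_less_asym)
    then have "h \<tau>1 = h \<tau>2"
      using \<sigma> L hom h by (intro continuous_from_reals_eqI[of \<tau>1 \<tau>2 \<sigma>])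
        (auto simp: in_L_def Rats_def homeomorphic_imp_continuous_map)
    \<comment> \<open>Both topologies consist of the preimages of the \<open>\<sigma>\<close>-open
      sets under the same bijection.\<close>
    then have "openin \<tau>1 U \<longleftrightarrow> openin \<tau>2 U" for U
      using homeomorphic_map_openness_eq[OF h[OF hom(1)]] homeomorphic_map_openness_eq[OF h[OF hom(2)]] L
      by (simp add: in_L_def)
    then show "\<tau>1 = \<tau>2"
      by (simp add: topology_eq)
  qed
  then show ?thesis
    unfolding lepoll_def by blast
qed

section \<open>Cardinal arithmetic and choice of representatives\<close>

lemma lepoll_total: "A \<lesssim> B \<or> B \<lesssim> A"
  unfolding lepoll_def using card_of_ordLeq ordLeq_total[OF card_of_Well_order card_of_Well_order] by metis

lemma infinite_times_self_eqpoll: "infinite A \<Longrightarrow> A \<times> A \<approx> A"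
  by (simp add: eqpoll_iff_card_of_ordIso card_of_Times_same_infinite)

text \<open>An \<open>A\<close> embedding in \<open>M\<close> would put \<open>Pow M\<close> into
  \<open>M \<times> M\<close> and so into \<open>M\<close>, against Cantor. Thus \<open>M\<close>
  embeds in \<open>A\<close>, and \<open>A \<times> M\<close> is absorbed by
  \<open>A \<times> A\<close>.\<close>

lemma Pow_lepoll_times_cancel:
  assumes "infinite M" and "Pow M \<lesssim> A \<times> M"
  shows "Pow M \<lesssim> A"
proof -
  have "M \<times> M \<lesssim> M"
    using infinite_times_self_eqpoll[OF assms(1)] eqpoll_imp_lepoll by blast
  have "\<not> A \<lesssim> M"
  proof
    assume "A \<lesssim> M"
    then have "A \<times> M \<lesssim> M \<times> M"
      by (intro times_lepoll_mono) auto
    then have "Pow M \<lesssim> M"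
      by (rule lepoll_trans[OF lepoll_trans[OF assms(2)] \<open>M \<times> M \<lesssim> M\<close>])
    then have "Pow M \<prec> Pow M"
      using lesspoll_Pow_self by (rule lesspoll_trans1)
    then show False by simp
  qed
  then have "M \<lesssim> A"
    using lepoll_total by blast
  then have "infinite A"
    using assms(1) lepoll_trans unfolding infinite_le_lepoll by blast
  have "A \<times> M \<lesssim> A \<times> A"
    using \<open>M \<lesssim> A\<close> by (intro times_lepoll_mono) auto
  then show ?thesis
    by (rule lepoll_trans2[OF lepoll_trans[OF assms(2)] infinite_times_self_eqpoll[OF \<open>infinite A\<close>]])
qed

text \<open>A point is recovered from the representative of its class and an index in
  \<open>M\<close> within that class; the factor \<open>M\<close> then cancels.\<close>

lemma representatives_eqpoll:
  assumes equiv: "\<And>x. x \<in> T \<Longrightarrow> R x x" "\<And>x y. R x y \<Longrightarrow> R y x" "\<And>x y z. R x y \<Longrightarrow> R y z \<Longrightarrow> R x z"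
    and "infinite M" "T \<approx> Pow M" and small: "\<And>y. y \<in> T \<Longrightarrow> {x \<in> T. R x y} \<lesssim> M"
  shows "\<exists>F\<subseteq>T. F \<approx> Pow M \<and> (\<forall>x\<in>F. \<forall>y\<in>F. x \<noteq> y \<longrightarrow> \<not> R x y)"
proof -
  define r where "r x = (SOME y. y \<in> T \<and> R x y)" for x
  have r: "r x \<in> T" "R x (r x)" if "x \<in> T" for x
    using someI[of "\<lambda>y. y \<in> T \<and> R x y" x] that equiv(1) by (auto simp: r_def)
  have r_cong: "r x = r y" if "R x y" for x y
  proof -
    \<comment> \<open>Equivalent points give the same choice predicate, so \<open>SOME\<close> picks
      the same representative.\<close>
    have "R x z \<longleftrightarrow> R y z" for z
      using that equiv(2,3) by blast
    then show ?thesis by (simp add: r_def)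
  qed
  obtain c where c: "\<And>y. y \<in> T \<Longrightarrow> inj_on (c y) {x \<in> T. R x y} \<and> c y ` {x \<in> T. R x y} \<subseteq> M"
    using small unfolding lepoll_def by metis
  have "T \<lesssim> r ` T \<times> M"
    unfolding lepoll_def
  proof (intro exI conjI)
    show "inj_on (\<lambda>x. (r x, c (r x) x)) T"
    proof (rule inj_onI, clarify)
      fix x y assume "x \<in> T" "y \<in> T" "r x = r y" "c (r x) x = c (r y) y"
      then show "x = y"
        using c[of "r x"] r[of x] r[of y] by (auto dest: inj_onD)
    qed
    show "(\<lambda>x. (r x, c (r x) x)) ` T \<subseteq> r ` T \<times> M"
      using c r by fastforce
  qed
  then have "Pow M \<lesssim> r ` T \<times> M"
    using assms(5) eqpoll_sym lepoll_trans1 by blast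
  then have "Pow M \<lesssim> r ` T"
    using assms(4) Pow_lepoll_times_cancel by blast
  moreover have "r ` T \<lesssim> Pow M"
    using image_lepoll assms(5) lepoll_trans2 by blast
  ultimately have "r ` T \<approx> Pow M"
    by (simp add: lepoll_antisym)
  moreover have "\<not> R x y" if "x \<in> r ` T" "y \<in> r ` T" "x \<noteq> y" for x y
    using that r r_cong by (metis imageE)
  moreover have "r ` T \<subseteq> T"
    using r(1) by blast
  ultimately show ?thesis
    by (intro exI[of _ "r ` T"]) simp
qed

theorem theorem5:
  shows "\<exists>\<F> :: real topology set.
           \<F> \<approx> (Pow (UNIV :: real set)) \<and>
           (\<forall>\<tau>\<in>\<F>. in_L \<tau> \<and> completely_normal_space \<tau> \<and> meager_space \<tau>) \<and>
           (\<forall>\<tau>1\<in>\<F>. \<forall>\<tau>2\<in>\<F>. \<tau>1 \<noteq> \<tau>2 \<longrightarrow> \<not> (\<tau>1 homeomorphic_space \<tau>2))"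
proof -
  let ?T = "range (\<lambda>X. bohr_topology (branch_family X))"
  have *: "in_L \<tau> \<and> completely_normal_space \<tau> \<and> meager_space \<tau>" if "\<tau> \<in> ?T" for \<tau>
    using that branch.in_L_bohr_topology branch.completely_normal_bohr_topology
      branch.meager_bohr_topology by blast
  \<comment> \<open>Counting is done with sets of naturals, the codes of homeomorphisms; this
    carries the result over to the reals.\<close>
  have reals: "Pow (UNIV :: nat set set) \<approx> Pow (UNIV :: real set)"
  proof -
    obtain f where "bij_betw f (UNIV :: nat set set) (UNIV :: real set)"
      using nat_sets_eqpoll_reals eqpoll_def by blast
    then show ?thesis
      unfolding eqpoll_def using bij_betw_Pow by blast
  qed
  have inf: "infinite (UNIV :: nat set set)"
    by (simp add: Finite_Set.finite_set)
  have eqT: "?T \<approx> Pow (UNIV :: nat set set)"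
    using inj_on_image_eqpoll_self[OF inj_bohr_topology_branch_family] by simp
  have small: "{\<tau> \<in> ?T. \<tau> homeomorphic_space \<sigma>} \<lesssim> (UNIV :: nat set set)" if "\<sigma> \<in> ?T" for \<sigma>
  proof -
    have "{\<tau> \<in> ?T. \<tau> homeomorphic_space \<sigma>} \<subseteq> {\<tau>. in_L \<tau> \<and> \<tau> homeomorphic_space \<sigma>}"
      using * by blast
    then show ?thesis
      using *[OF that] by (intro lepoll_trans[OF subset_imp_lepoll homeomorphism_class_lepoll]) auto
  qed
  have "\<exists>F\<subseteq>?T. F \<approx> Pow (UNIV :: nat set set) \<and>
      (\<forall>\<tau>1\<in>F. \<forall>\<tau>2\<in>F. \<tau>1 \<noteq> \<tau>2 \<longrightarrow> \<not> \<tau>1 homeomorphic_space \<tau>2)"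
  proof (rule representatives_eqpoll)
    show "\<tau>1 homeomorphic_space \<tau>2 \<Longrightarrow> \<tau>2 homeomorphic_space \<tau>1" for \<tau>1 \<tau>2 :: "real topology"
      by (rule homeomorphic_space_sym[THEN iffD1])
    show "\<tau>1 homeomorphic_space \<tau>2 \<Longrightarrow> \<tau>2 homeomorphic_space \<tau>3 \<Longrightarrow> \<tau>1 homeomorphic_space \<tau>3"
      for \<tau>1 \<tau>2 \<tau>3 :: "real topology"
      by (rule homeomorphic_space_trans)
  qed (erule small | rule homeomorphic_space_refl inf eqT)+
  then obtain F where F: "F \<subseteq> ?T" "F \<approx> Pow (UNIV :: nat set set)"
    "\<forall>\<tau>1\<in>F. \<forall>\<tau>2\<in>F. \<tau>1 \<noteq> \<tau>2 \<longrightarrow> \<not> \<tau>1 homeomorphic_space \<tau>2"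
    by blast
  have "F \<approx> Pow (UNIV :: real set)"
    using F(2) reals by (rule eqpoll_trans)
  moreover have "\<forall>\<tau>\<in>F. in_L \<tau> \<and> completely_normal_space \<tau> \<and> meager_space \<tau>"
    using F(1) * by (meson subsetD)
  ultimately show ?thesis
    using F(3) by (intro exI[of _ F] conjI)
qed

end
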